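(* Let $g_n$ be the number of unlabeled graphs on $n$ nodes. Then $$g_n \sim \frac{2^{\binom{n}{2}}}{n!},$$ that is, $\lim_{n\to\infty} g_n\, n!/2^{\binom{n}{2}} = 1$.
   Context: Graphs are simple and undirected. Two labeled graphs on the node set $\{0,1,\ldots,n-1\}$ are equivalent if some relabeling (permutation of the nodes) makes them equal. An unlabeled graph on $n$ nodes is an equivalence class of labeled graphs; thus $g_n$ is the number of isomorphism classes of undirected graphs on $\{0,1,\ldots,n-1\}$. *)

theory Defs
  imports
    Complex_Main
    "HOL-Combinatorics.Permutations"
    "HOL-Library.Landau_Symbols"
begin

text \<open>
  A labeled graph on the node set \<open>{0..<n}\<close> is represented by its edge set, a set of
  two-element subsets of \<open>{0..<n}\<close>; isolated nodes are accounted for by the parameter \<open>n\<close>.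
\<close>

definition labeled_graphs :: "nat \<Rightarrow> nat set set set" where
  "labeled_graphs n = Pow {e. e \<subseteq> {0..<n} \<and> card e = 2}"

definition relabel :: "(nat \<Rightarrow> nat) \<Rightarrow> nat set set \<Rightarrow> nat set set" where
  "relabel p E = (\<lambda>e. p ` e) ` E"

definition graph_equivalence :: "nat \<Rightarrow> (nat set set \<times> nat set set) set" where
  "graph_equivalence n =
     {(E, F). E \<in> labeled_graphs n \<and> F \<in> labeled_graphs n \<and>
              (\<exists>p. p permutes {0..<n} \<and> relabel p E = F)}"

lemma equiv_graph_equivalence: "equiv (labeled_graphs n) (graph_equivalence n)"
proof (rule equivI)
  show "graph_equivalence n \<subseteq> labeled_graphs n \<times> labeled_graphs n"
    by (auto simp: graph_equivalence_def)
  have "relabel id E = E" for E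
    by (simp add: relabel_def)
  then show "refl_on (labeled_graphs n) (graph_equivalence n)"
    by (auto simp: refl_on_def graph_equivalence_def intro!: exI[of _ id] permutes_id)
  show "sym (graph_equivalence n)"
  proof (rule symI)
    fix E F assume "(E, F) \<in> graph_equivalence n"
    then obtain p where E: "E \<in> labeled_graphs n" and F: "F \<in> labeled_graphs n"
      and p: "p permutes {0..<n}" and eq: "relabel p E = F"
      by (auto simp: graph_equivalence_def)
    have "relabel (inv p) F = E"
      using permutes_inj[OF p] by (simp add: eq[symmetric] relabel_def image_image)
    with E F permutes_inv[OF p] show "(F, E) \<in> graph_equivalence n"
      by (auto simp: graph_equivalence_def)
  qed
  show "trans (graph_equivalence n)"
  proof (rule transI)
    fix E F G assume EF: "(E, F) \<in> graph_equivalence n" and FG: "(F, G) \<in> graph_equivalence n"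
    from EF obtain p where p: "p permutes {0..<n}" "relabel p E = F"
      by (auto simp: graph_equivalence_def)
    from FG obtain q where q: "q permutes {0..<n}" "relabel q F = G"
      by (auto simp: graph_equivalence_def)
    have "relabel (q \<circ> p) E = G"
      using p q by (auto simp: relabel_def image_image)
    with EF FG permutes_compose[OF p(1) q(1)] show "(E, G) \<in> graph_equivalence n"
      by (auto simp: graph_equivalence_def)
  qed
qed

definition unlabeled_graphs :: "nat \<Rightarrow> nat set set set set" where
  "unlabeled_graphs n = labeled_graphs n // graph_equivalence n"

definition num_unlabeled_graphs :: "nat \<Rightarrow> nat" where
  "num_unlabeled_graphs n = card (unlabeled_graphs n)"

lemma finite_unlabeled_graphs: "finite (unlabeled_graphs n)"
proof -
  have "finite {e. e \<subseteq> {0..<n} \<and> card e = 2}"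
    by (rule finite_subset[of _ "Pow {0..<n}"]) auto
  then have "finite (labeled_graphs n)"
    by (simp add: labeled_graphs_def)
  then show ?thesis
    unfolding unlabeled_graphs_def
    by (rule finite_quotient) (auto simp: graph_equivalence_def)
qed

end

theory Submission
  imports Defs "HOL-Algebra.Group_Action" "HOL-Real_Asymp.Real_Asymp"
begin

text \<open>
  Almost every graph has no symmetry besides the identity, so a typical isomorphism class
  consists of \<open>n!\<close> labeled graphs. Burnside's lemma makes this quantitative:
  \<open>n!\<close> times the number of unlabeled graphs is the sum, over all permutations \<open>p\<close> of the
  nodes, of the number of labeled graphs fixed by \<open>p\<close> (lemma
  \<open>num_unlabeled_graphs_times_fact\<close>). The identity alone contributes the expected main term
  \<open>2 ^ (n choose 2)\<close>, which is already the lower bound; it remains to show that the other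
  permutations together contribute a vanishing fraction of it.

  A graph fixed by \<open>p\<close> is a union of orbits of \<open>p\<close> on the node pairs. An orbit that is not
  a fixed point has at least two elements, so if \<open>p\<close> moves \<open>M\<close> pairs, it fixes at most
  \<open>2 ^ ((n choose 2) - M / 2)\<close> graphs (lemma \<open>card_invariant_sets_bound\<close>). A permutation that
  moves \<open>m\<close> nodes moves at least \<open>m (n - 2) / 2\<close> pairs (lemma \<open>card_moved_pairs_ge\<close>), hence
  it fixes at most a fraction \<open>r ^ m\<close> of all graphs, where \<open>r = 2 powr (- (n - 2) / 4)\<close>.

  Every moved node thus costs a factor \<open>r\<close>, and it has fewer than \<open>n\<close> possible images.
  Bounding the sum over permutations by the sum over all self-maps of the node set, which
  factorises over the nodes, gives at most \<open>(1 + n r) ^ n\<close> (lemma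
  \<open>sum_permutes_power_moved_le\<close>). This tends to 1 because \<open>r\<close> decays exponentially.
\<close>

section \<open>Labeled graphs as sets of node pairs\<close>

definition pairs :: "nat \<Rightarrow> nat set set" where
  "pairs n = {e. e \<subseteq> {0..<n} \<and> card e = 2}"

definition fixed_graphs :: "nat \<Rightarrow> (nat \<Rightarrow> nat) \<Rightarrow> nat set set set" where
  "fixed_graphs n p = {E \<in> labeled_graphs n. relabel p E = E}"

lemma labeled_graphs_eq_Pow_pairs: "labeled_graphs n = Pow (pairs n)"
  by (simp add: labeled_graphs_def pairs_def)

lemma finite_pairs: "finite (pairs n)"
  by (rule finite_subset[of _ "Pow {0..<n}"]) (auto simp: pairs_def)

lemma card_pairs: "card (pairs n) = n choose 2"
  using n_subsets[of "{0..<n}" 2] by (simp add: pairs_def)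

lemma finite_labeled_graphs: "finite (labeled_graphs n)"
  by (simp add: labeled_graphs_eq_Pow_pairs finite_pairs)

lemma card_labeled_graphs: "card (labeled_graphs n) = 2 ^ (n choose 2)"
  by (simp add: labeled_graphs_eq_Pow_pairs card_Pow finite_pairs card_pairs)

lemma image_in_pairs:
  assumes "p permutes {0..<n}" "e \<in> pairs n"
  shows "p ` e \<in> pairs n"
proof -
  have "card (p ` e) = card e"
    by (rule card_image[OF inj_on_subset[OF permutes_inj[OF assms(1)] subset_UNIV]])
  moreover have "p ` e \<subseteq> {0..<n}"
    using assms(2) permutes_image[OF assms(1)] image_mono[of e "{0..<n}" p]
    by (simp add: pairs_def)
  ultimately show ?thesis
    using assms(2) by (simp add: pairs_def)
qed

lemma relabel_in_labeled_graphs: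
  assumes "p permutes {0..<n}" "E \<in> labeled_graphs n"
  shows "relabel p E \<in> labeled_graphs n"
  using assms image_in_pairs[OF assms(1)]
  by (auto simp: labeled_graphs_eq_Pow_pairs relabel_def)

section \<open>Counting isomorphism classes by Burnside's lemma\<close>

definition node_permutations :: "nat \<Rightarrow> (nat \<Rightarrow> nat) monoid" where
  "node_permutations n = \<lparr>carrier = {p. p permutes {0..<n}}, mult = (\<circ>), one = id\<rparr>"

text \<open>
  Relabeling is restricted to the labeled graphs, with the value \<open>undefined\<close> elsewhere, since
  the elements of the group \<open>BijGroup\<close> are extensional functions.
\<close>

definition relabel_action :: "nat \<Rightarrow> (nat \<Rightarrow> nat) \<Rightarrow> nat set set \<Rightarrow> nat set set" where
  "relabel_action n p = restrict (relabel p) (labeled_graphs n)"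

lemma group_node_permutations: "group (node_permutations n)"
proof (rule groupI)
  fix p assume "p \<in> carrier (node_permutations n)"
  then show "\<exists>q\<in>carrier (node_permutations n).
      q \<otimes>\<^bsub>node_permutations n\<^esub> p = \<one>\<^bsub>node_permutations n\<^esub>"
    by (auto simp: node_permutations_def intro!: bexI[of _ "inv_into UNIV p"] permutes_inv permutes_inv_o)
qed (auto simp: node_permutations_def permutes_compose comp_assoc)

lemma relabel_action_in_Bij:
  assumes p: "p permutes {0..<n}"
  shows "relabel_action n p \<in> Bij (labeled_graphs n)"
proof -
  have cancel: "relabel (inv_into UNIV q) (relabel q E) = E" if "q permutes {0..<n}" for q E
    using permutes_inj[OF that] by (simp add: relabel_def image_image)
  have "bij_betw (relabel p) (labeled_graphs n) (labeled_graphs n)"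
    using p permutes_inv[OF p] cancel[OF p] cancel[OF permutes_inv[OF p]] permutes_inv_inv[OF p]
    by (intro bij_betwI[of _ _ _ "relabel (inv_into UNIV p)"] relabel_in_labeled_graphs funcsetI) auto
  then show ?thesis
    by (simp add: Bij_def relabel_action_def)
qed

lemma group_action_relabel:
  "group_action (node_permutations n) (labeled_graphs n) (relabel_action n)"
proof -
  have "relabel_action n \<in> hom (node_permutations n) (BijGroup (labeled_graphs n))"
  proof (rule homI)
    fix p q assume "p \<in> carrier (node_permutations n)" "q \<in> carrier (node_permutations n)"
    then have p: "p permutes {0..<n}" and q: "q permutes {0..<n}"
      by (simp_all add: node_permutations_def)
    have "relabel_action n (p \<circ> q)
        = compose (labeled_graphs n) (relabel_action n p) (relabel_action n q)"
      using relabel_in_labeled_graphs[OF q]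
      by (auto simp: fun_eq_iff relabel_action_def compose_def relabel_def image_image)
    then show "relabel_action n (p \<otimes>\<^bsub>node_permutations n\<^esub> q)
        = relabel_action n p \<otimes>\<^bsub>BijGroup (labeled_graphs n)\<^esub> relabel_action n q"
      using relabel_action_in_Bij[OF p] relabel_action_in_Bij[OF q]
      by (simp add: node_permutations_def BijGroup_def)
  qed (simp add: node_permutations_def BijGroup_def relabel_action_in_Bij)
  then show ?thesis
    by (intro group_action.intro group_hom.intro group_hom_axioms.intro
        group_node_permutations group_BijGroup)
qed

lemma orbits_relabel_eq_unlabeled_graphs:
  "orbits (node_permutations n) (labeled_graphs n) (relabel_action n) = unlabeled_graphs n"
proof -
  have "orbit (node_permutations n) (relabel_action n) E = graph_equivalence n `` {E}"
    if "E \<in> labeled_graphs n" for E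
    using that relabel_in_labeled_graphs[OF _ that]
    by (auto simp: orbit_def node_permutations_def relabel_action_def graph_equivalence_def)
  then show ?thesis
    by (auto simp: orbits_def unlabeled_graphs_def quotient_def)
qed

lemma num_unlabeled_graphs_times_fact:
  "num_unlabeled_graphs n * fact n = (\<Sum>p | p permutes {0..<n}. card (fixed_graphs n p))"
proof -
  have "invariants (labeled_graphs n) (relabel_action n) p = fixed_graphs n p" for p
    by (auto simp: invariants_def fixed_graphs_def relabel_action_def)
  moreover have "order (node_permutations n) = fact n"
    by (simp add: order_def node_permutations_def card_permutations)
  moreover have "carrier (node_permutations n) = {p. p permutes {0..<n}}"
    by (simp add: node_permutations_def)
  ultimately show ?thesis
    using group_action.burnside[OF group_action_relabel, of n] finite_labeled_graphs[of n]
    by (simp add: orbits_relabel_eq_unlabeled_graphs num_unlabeled_graphs_def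
        finite_permutations)
qed

section \<open>Sets invariant under a permutation\<close>

text \<open>
  Think of \<open>h\<close> as a height. An invariant set contains \<open>x\<close> if and only if it contains \<open>s x\<close>. If
  \<open>s x\<close> lies below \<open>x\<close>, membership of \<open>x\<close> is therefore decided at a smaller height, and by
  induction an invariant set is determined by its trace on the points at which \<open>s\<close> does not
  descend. These points meet every orbit and so stand in for a system of representatives.
\<close>
lemma card_invariant_sets_le_ascents:
  fixes h :: "'a \<Rightarrow> nat"
  assumes fin: "finite X" and inj: "inj_on s X" and maps: "s ` X \<subseteq> X"
  shows "card {E. E \<subseteq> X \<and> s ` E = E} \<le> 2 ^ card {x \<in> X. h x \<le> h (s x)}"
proof -
  let ?R = "{x \<in> X. h x \<le> h (s x)}"
  have inj_trace: "inj_on (\<lambda>E. E \<inter> ?R) {E. E \<subseteq> X \<and> s ` E = E}"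
  proof (rule inj_onI)
    fix E F
    assume E: "E \<in> {E. E \<subseteq> X \<and> s ` E = E}" and F: "F \<in> {E. E \<subseteq> X \<and> s ` E = E}"
      and trace: "E \<inter> ?R = F \<inter> ?R"
    \<comment> \<open>Injectivity gives the backward direction: only \<open>x\<close> is mapped to \<open>s x\<close>.\<close>
    have step: "x \<in> G \<longleftrightarrow> s x \<in> G" if "x \<in> X" "G \<subseteq> X" "s ` G = G" for x G
      using that inj by (metis imageI inj_on_image_mem_iff)
    have "x \<in> X \<longrightarrow> (x \<in> E \<longleftrightarrow> x \<in> F)" for x
    proof (induction x rule: measure_induct_rule[of h])
      case (less x)
      show ?case
      proof (intro impI, cases "h x \<le> h (s x)")
        case True
        assume "x \<in> X"
        with True trace show "x \<in> E \<longleftrightarrow> x \<in> F" by blast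
      next
        case False
        assume x: "x \<in> X"
        with maps have "s x \<in> X" by blast
        with less[of "s x"] False have "s x \<in> E \<longleftrightarrow> s x \<in> F" by simp
        with step[OF x] E F show "x \<in> E \<longleftrightarrow> x \<in> F" by blast
      qed
    qed
    with E F show "E = F" by blast
  qed
  have "card {E. E \<subseteq> X \<and> s ` E = E} \<le> card (Pow ?R)"
    by (rule card_inj_on_le[OF inj_trace]) (use fin in auto)
  then show ?thesis
    using fin by (simp add: card_Pow)
qed

text \<open>
  Apply the previous bound with an injective height \<open>h\<close> and with the reversed height \<open>K - h\<close>. A
  moved point is a descent for exactly one of the two, whereas a fixed point is a descent for
  neither. So the two exponents add up to at most \<open>2 * card X\<close> minus the number of moved
  points, and the product of the two bounds is the claim. Taking the product, and hence the
  square on the left, avoids deciding which of the two heights gives the better bound.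
\<close>
lemma card_invariant_sets_bound:
  assumes fin: "finite X" and inj: "inj_on s X" and maps: "s ` X \<subseteq> X"
  shows "card {E. E \<subseteq> X \<and> s ` E = E} ^ 2 * 2 ^ card {x \<in> X. s x \<noteq> x} \<le> 4 ^ card X"
proof -
  let ?N = "card {E. E \<subseteq> X \<and> s ` E = E}" and ?M = "{x \<in> X. s x \<noteq> x}"
  from finite_imp_inj_to_nat_seg[OF fin] obtain h :: "'a \<Rightarrow> nat" and K
    where h: "inj_on h X" "h ` X = {i. i < K}" by blast
  let ?A = "{x \<in> X. h x \<le> h (s x)}" and ?B = "{x \<in> X. K - h x \<le> K - h (s x)}"
  have finA: "finite ?A" and finB: "finite ?B" and finM: "finite ?M"
    using fin by auto
  have hlt: "h x < K" if "x \<in> X" for x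
    using h(2) that by auto
  have "?A \<inter> ?B \<inter> ?M = {}"
  proof -
    have "s x = x" if "x \<in> X" "h x \<le> h (s x)" "K - h x \<le> K - h (s x)" for x
    proof -
      have "s x \<in> X" using that maps by blast
      then have "h (s x) = h x" using that hlt[of x] hlt[of "s x"] by linarith
      then show ?thesis using h(1) \<open>s x \<in> X\<close> that(1) by (simp add: inj_on_def)
    qed
    then show ?thesis by blast
  qed
  then have "card (?A \<inter> ?B) + card ?M = card (?A \<inter> ?B \<union> ?M)"
    by (intro card_Un_disjoint[symmetric]) (use fin in auto)
  also have "\<dots> \<le> card X"
    by (rule card_mono[OF fin]) auto
  finally have 1: "card (?A \<inter> ?B) + card ?M \<le> card X" .
  have "card ?A + card ?B = card (?A \<union> ?B) + card (?A \<inter> ?B)"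
    by (rule card_Un_Int[OF finA finB])
  moreover have "card (?A \<union> ?B) \<le> card X"
    by (rule card_mono[OF fin]) auto
  ultimately have 2: "card ?A + card ?B + card ?M \<le> 2 * card X"
    using 1 by linarith
  have "?N ^ 2 * 2 ^ card ?M \<le> 2 ^ card ?A * 2 ^ card ?B * 2 ^ card ?M"
    unfolding power2_eq_square
    by (intro mult_mono card_invariant_sets_le_ascents assms) auto
  also have "\<dots> = 2 ^ (card ?A + card ?B + card ?M)"
    by (simp add: power_add)
  also have "\<dots> \<le> 2 ^ (2 * card X)"
    using 2 by (intro power_increasing) auto
  also have "\<dots> = 4 ^ card X"
    by (simp add: power_mult)
  finally show ?thesis .
qed

section \<open>The fraction of graphs fixed by a permutation\<close>

text \<open>
  If \<open>p\<close> moves \<open>i\<close>, the only pair containing \<open>i\<close> that \<open>p\<close> can fix is \<open>{i, p i}\<close>. So each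
  moved node \<open>i\<close> lies in a moved pair \<open>{i, j}\<close> for each of the \<open>n - 2\<close> nodes \<open>j\<close> other than
  \<open>i\<close> and \<open>p i\<close>. The factor 2 is the number of nodes of a pair from which it can be reached.
\<close>
lemma card_moved_pairs_ge:
  assumes p: "p permutes {0..<n}"
  shows "card {i \<in> {0..<n}. p i \<noteq> i} * (n - 2) \<le> 2 * card {e \<in> pairs n. p ` e \<noteq> e}"
proof -
  let ?S = "{i \<in> {0..<n}. p i \<noteq> i}" and ?M = "{e \<in> pairs n. p ` e \<noteq> e}"
  let ?D = "SIGMA i:?S. {0..<n} - {i, p i}"
  have finM: "finite ?M"
    using finite_pairs by auto
  have fine: "finite e" if "e \<in> ?M" for e
    using that by (auto simp: pairs_def intro: card_ge_0_finite)
  have "card ?D = (\<Sum>i\<in>?S. n - 2)"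
  proof (subst card_SigmaI)
    show "(\<Sum>i\<in>?S. card ({0..<n} - {i, p i})) = (\<Sum>i\<in>?S. n - 2)"
    proof (rule sum.cong)
      fix i assume i: "i \<in> ?S"
      then have "p i \<in> {0..<n}" using permutes_in_image[OF p, of i] by simp
      with i show "card ({0..<n} - {i, p i}) = n - 2"
        by (subst card_Diff_subset) (auto simp: card_insert_if)
    qed simp
  qed auto
  then have "card ?S * (n - 2) = card ?D"
    by simp
  also have "\<dots> \<le> card (SIGMA e:?M. e)"
  proof (rule card_inj_on_le[of "\<lambda>(i, j). ({i, j}, i)"])
    show "inj_on (\<lambda>(i, j). ({i, j}, i)) ?D"
      by (auto simp: inj_on_def doubleton_eq_iff)
    show "(\<lambda>(i, j). ({i, j}, i)) ` ?D \<subseteq> (SIGMA e:?M. e)"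
      by (auto simp: pairs_def doubleton_eq_iff)
    show "finite (SIGMA e:?M. e)"
      by (intro finite_SigmaI finM fine)
  qed
  also have "\<dots> = (\<Sum>e\<in>?M. card e)"
    using finM fine by simp
  also have "\<dots> = (\<Sum>e\<in>?M. 2)"
    by (rule sum.cong) (simp_all add: pairs_def)
  also have "\<dots> = 2 * card ?M"
    by simp
  finally show ?thesis .
qed

text \<open>
  The truncated difference \<open>n - 2\<close> is the one from the count of moved pairs, so the estimate
  below also covers \<open>n < 2\<close>.
\<close>
definition moved_point_weight :: "nat \<Rightarrow> real" where
  "moved_point_weight n = 2 powr (- real (n - 2) / 4)"

text \<open>
  Passing to fourth powers turns both square roots into integer exponents: one comes from
  the square in the bound on invariant sets, the other from each moved pair being counted
  twice.
\<close>
lemma fixed_graphs_fraction_le: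
  assumes p: "p permutes {0..<n}"
  shows "card (fixed_graphs n p) / 2 ^ (n choose 2)
       \<le> moved_point_weight n ^ card {i \<in> {0..<n}. p i \<noteq> i}"
proof -
  let ?N = "card (fixed_graphs n p)" and ?m = "card {i \<in> {0..<n}. p i \<noteq> i}"
    and ?M = "card {e \<in> pairs n. p ` e \<noteq> e}" and ?C = "n choose 2"
  have "?N ^ 2 * 2 ^ ?M \<le> 4 ^ ?C"
  proof -
    have "inj_on ((`) p) (pairs n)"
      using permutes_inj[OF p] by (auto simp: inj_on_def inj_image_eq_iff)
    moreover have "(`) p ` pairs n \<subseteq> pairs n"
      using image_in_pairs[OF p] by auto
    moreover have "fixed_graphs n p = {E. E \<subseteq> pairs n \<and> (`) p ` E = E}"
      by (auto simp: fixed_graphs_def labeled_graphs_eq_Pow_pairs relabel_def)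
    ultimately show ?thesis
      using card_invariant_sets_bound[of "pairs n" "(`) p"] by (simp add: finite_pairs card_pairs)
  qed
  then have "real (?N ^ 2 * 2 ^ ?M) \<le> real (4 ^ ?C)"
    by (rule of_nat_mono)
  then have "real ?N ^ 2 * 2 ^ ?M \<le> (2 ^ ?C) ^ 2"
    by (simp add: power_mult[symmetric] mult.commute[of _ 2]) (simp add: power_mult)
  then have sq: "(?N / 2 ^ ?C) ^ 2 \<le> 1 / 2 ^ ?M"
    by (simp add: power_divide field_simps)
  have "(?N / 2 ^ ?C) ^ 4 = ((?N / 2 ^ ?C) ^ 2) ^ 2"
    by (simp flip: power_mult)
  also have "\<dots> \<le> (1 / 2 ^ ?M) ^ 2"
    using sq by (intro power_mono) auto
  also have "\<dots> = 1 / 2 ^ (2 * ?M)"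
    by (simp add: power_divide power_mult[symmetric] mult.commute)
  also have "\<dots> \<le> 1 / 2 ^ (?m * (n - 2))"
    using card_moved_pairs_ge[OF p] by (intro divide_left_mono power_increasing) auto
  also have "\<dots> = (moved_point_weight n ^ ?m) ^ 4"
  proof -
    have "moved_point_weight n ^ 4 = 2 powr (- real (n - 2))"
      by (simp add: moved_point_weight_def powr_power)
    also have "\<dots> = 1 / 2 ^ (n - 2)"
      by (simp add: powr_minus powr_realpow divide_inverse)
    finally have "(moved_point_weight n ^ 4) ^ ?m = (1 / 2 ^ (n - 2)) ^ ?m"
      by simp
    then show ?thesis
      by (simp add: power_divide power_mult[symmetric] mult.commute)
  qed
  finally show ?thesis
    by (rule power_le_imp_le_base[of _ 3, simplified])
       (simp add: moved_point_weight_def)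
qed

section \<open>The sum over all permutations\<close>

text \<open>
  Replace the permutations by the larger set of all maps \<open>f\<close> from \<open>{0..<n}\<close> to itself. The
  weight of \<open>f\<close> is a product with one factor per point, namely 1 if \<open>f\<close> fixes the point and
  \<open>r\<close> otherwise. So the sum of the weights is the product over all points of
  \<open>1 + (n - 1) * r\<close>.
\<close>
lemma sum_permutes_power_moved_le:
  fixes r :: real
  assumes "r \<ge> 0"
  shows "(\<Sum>p | p permutes {0..<n}. r ^ card {i \<in> {0..<n}. p i \<noteq> i}) \<le> (1 + n * r) ^ n"
proof -
  let ?A = "{0..<n}" and ?P = "{p. p permutes {0..<n}}"
  define w :: "nat \<Rightarrow> nat \<Rightarrow> real" where "w i j = (if j = i then 1 else r)" for i j
  have w0: "w i j \<ge> 0" for i j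
    using assms by (simp add: w_def)
  have weight: "r ^ card {i \<in> ?A. p i \<noteq> i} = (\<Prod>i\<in>?A. w i (restrict p ?A i))" for p
  proof -
    have "(\<Prod>i\<in>?A. w i (restrict p ?A i)) = (\<Prod>i\<in>?A. if p i \<noteq> i then r else 1)"
      by (intro prod.cong) (auto simp: w_def)
    also have "\<dots> = (\<Prod>i\<in>{i \<in> ?A. p i \<noteq> i}. r)"
      by (rule prod.inter_filter[symmetric]) simp
    finally show ?thesis by simp
  qed
  have inj: "inj_on (\<lambda>p. restrict p ?A) ?P"
  proof (rule inj_onI, rule ext)
    fix p q i
    assume "p \<in> ?P" "q \<in> ?P" and eq: "restrict p ?A = restrict q ?A"
    have "p i = q i" if "i \<in> ?A"
      using fun_cong[OF eq, of i] that by simp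
    moreover have "p i = q i" if "i \<notin> ?A"
      using that \<open>p \<in> ?P\<close> \<open>q \<in> ?P\<close> by (metis mem_Collect_eq permutes_not_in)
    ultimately show "p i = q i" by blast
  qed
  have "(\<Sum>p\<in>?P. r ^ card {i \<in> ?A. p i \<noteq> i})
      = (\<Sum>f\<in>(\<lambda>p. restrict p ?A) ` ?P. \<Prod>i\<in>?A. w i (f i))"
    by (simp only: sum.reindex[OF inj] o_def weight)
  also have "\<dots> \<le> (\<Sum>f\<in>PiE ?A (\<lambda>_. ?A). \<Prod>i\<in>?A. w i (f i))"
    by (rule sum_mono2)
       (auto simp: w0 finite_PiE permutes_in_image[of _ ?A, simplified] intro!: prod_nonneg)
  also have "\<dots> = (\<Prod>i\<in>?A. \<Sum>j\<in>?A. w i j)"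
    by (rule prod_sum_PiE[symmetric]) auto
  also have "\<dots> \<le> (\<Prod>i\<in>?A. 1 + n * r)"
  proof (rule prod_mono, intro conjI sum_nonneg w0)
    fix i assume "i \<in> ?A"
    have "(\<Sum>j\<in>?A. w i j) \<le> (\<Sum>j\<in>?A. (if j = i then 1 else 0) + r)"
      using assms by (intro sum_mono) (simp add: w_def)
    also have "\<dots> = 1 + n * r"
      using \<open>i \<in> ?A\<close> by (simp add: sum.distrib)
    finally show "(\<Sum>j\<in>?A. w i j) \<le> 1 + n * r" .
  qed
  also have "\<dots> = (1 + n * r) ^ n"
    by simp
  finally show ?thesis .
qed

section \<open>The asymptotic formula\<close>

lemma unlabeled_graphs_ratio_ge: "1 \<le> num_unlabeled_graphs n * fact n / 2 ^ (n choose 2)"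
proof -
  have "2 ^ (n choose 2) = card (fixed_graphs n id)"
    by (simp add: fixed_graphs_def relabel_def card_labeled_graphs)
  also have "\<dots> \<le> num_unlabeled_graphs n * fact n"
    unfolding num_unlabeled_graphs_times_fact
    by (rule member_le_sum[of id]) (simp_all add: finite_permutations)
  finally have "real (2 ^ (n choose 2)) \<le> real (num_unlabeled_graphs n * fact n)"
    by (rule of_nat_mono)
  then show ?thesis
    by (simp add: field_simps)
qed

lemma unlabeled_graphs_ratio_le:
  "num_unlabeled_graphs n * fact n / 2 ^ (n choose 2) \<le> (1 + n * moved_point_weight n) ^ n"
proof -
  have "real (num_unlabeled_graphs n) * fact n = real (num_unlabeled_graphs n * fact n)"
    by simp
  then have "num_unlabeled_graphs n * fact n / 2 ^ (n choose 2)
      = (\<Sum>p | p permutes {0..<n}. card (fixed_graphs n p) / 2 ^ (n choose 2))"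
    by (simp only: num_unlabeled_graphs_times_fact of_nat_sum sum_divide_distrib)
  also have "\<dots> \<le> (\<Sum>p | p permutes {0..<n}.
      moved_point_weight n ^ card {i \<in> {0..<n}. p i \<noteq> i})"
    by (intro sum_mono fixed_graphs_fraction_le) simp
  also have "\<dots> \<le> (1 + n * moved_point_weight n) ^ n"
    by (rule sum_permutes_power_moved_le) (simp add: moved_point_weight_def)
  finally show ?thesis .
qed

lemma tendsto_moved_point_bound: "(\<lambda>n. (1 + n * moved_point_weight n) ^ n) \<longlonglongrightarrow> 1"
proof -
  have "(\<lambda>n::nat. (1 + real n * 2 powr (- (real n - 2) / 4)) powr real n) \<longlonglongrightarrow> 1"
    by real_asymp
  moreover have "\<forall>\<^sub>F n in sequentially. (1 + real n * 2 powr (- (real n - 2) / 4)) powr real n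
      = (1 + n * moved_point_weight n) ^ n"
    using eventually_ge_at_top[of 2]
  proof eventually_elim
    case (elim n)
    have "1 + real n * moved_point_weight n > 0"
      by (intro add_pos_nonneg) (auto simp: moved_point_weight_def)
    with elim show ?case
      by (simp add: powr_realpow moved_point_weight_def of_nat_diff)
  qed
  ultimately show ?thesis
    by (rule Lim_transform_eventually)
qed

theorem theorem2p11:
  shows "(\<lambda>n. real (num_unlabeled_graphs n)) \<sim>[at_top] (\<lambda>n. 2 ^ (n choose 2) / fact n)
    \<and> (\<lambda>n. real (num_unlabeled_graphs n) * fact n / 2 ^ (n choose 2)) \<longlonglongrightarrow> 1"
proof
  show lim: "(\<lambda>n. real (num_unlabeled_graphs n) * fact n / 2 ^ (n choose 2)) \<longlonglongrightarrow> 1"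
    using unlabeled_graphs_ratio_ge unlabeled_graphs_ratio_le
    by (intro tendsto_sandwich[OF _ _ tendsto_const tendsto_moved_point_bound]
        always_eventually allI) simp_all
  show "(\<lambda>n. real (num_unlabeled_graphs n)) \<sim>[at_top] (\<lambda>n. 2 ^ (n choose 2) / fact n)"
    by (rule asymp_equivI') (use lim in simp)
qed

end
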